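(* Let $\tau_{\mathcal R}>0$ and $\tau_\psi>0$, and let $\mathcal Z_c\subset\mathbb R^m$ be nonempty and compact. Suppose that: (1) for each $k=1,\dots,m$ the map $\frac{\partial A}{\partial z_k}$ is Lipschitz continuous on $\mathbb R^m$; (2) there is $C_A>0$ with $\left\|\frac{\partial A}{\partial z_k}(z)\right\|_2\le C_A$ for all $z\in\mathbb R^m$ and $k=1,\dots,m$; (3) the map $\frac{\partial b}{\partial z}$ is Lipschitz continuous on $\mathbb R^m$; (4) there is $C_b>0$ with $\left\|\frac{\partial b}{\partial z}(z)\right\|_2\le C_b$ for all $z\in\mathbb R^m$; (5) $F\in C^1(\mathbb R^m\times\mathbb R^n,\mathbb R)$ is $L_F$-smooth with $L_F>0$, i.e. $\|\nabla F(w_1)-\nabla F(w_2)\|_2\le L_F\|w_1-w_2\|_2$ for all $w_1,w_2$. Let $\zeta>0$ and $\omega\in(0,1)$, let $$\gamma_1\in\left(0,\frac{\omega\zeta}{\overline D_{\mathcal R}}\right],\qquad \gamma_2\in\left(0,\frac{(1-\omega)\zeta}{\overline D_\psi}\right],$$ and let $z\in\mathcal Z_c$, $y\in\mathcal Y_z$, $\psi\in\mathcal A_{z,y}$, with $\overline\nabla\widetilde F(z)$ the inexact adjoint gradient formed from $(y,\psi)$. If $$\tau_{\mathcal R}=\gamma_1\|\overline\nabla\widetilde F(z)\|_2,\qquad \tau_\psi=\gamma_2\|\overline\nabla\widetilde F(z)\|_2,$$ then $$\|\overline\nabla\widetilde F(z)-\nabla\widetilde F(z)\|_2\le\zeta\,\|\overline\nabla\widetilde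 F(z)\|_2.$$
   Context: Vectors carry the Euclidean norm $\|\cdot\|_2$ and matrices the induced spectral norm $\|\cdot\|_2$. The residual is affine in the state: $R(z,y)=A(z)y-b(z)$, where $A:\mathbb R^m\to GL(n)$ (invertible real $n\times n$ matrices) and $b:\mathbb R^m\to\mathbb R^n$ are $C^1$. Its partial Jacobian in $z$ is the $n\times m$ matrix $\frac{\partial R}{\partial z}(z,y)=\frac{\partial A}{\partial z}(z)y-\frac{\partial b}{\partial z}(z)$, where $\frac{\partial A}{\partial z}(z)y$ is the matrix whose $k$-th column is $\frac{\partial A}{\partial z_k}(z)y$. $F:\mathbb R^m\times\mathbb R^n\to\mathbb R$ is the full objective, with partial gradients $\nabla_zF,\nabla_yF$. For each $z$: the exact state is $y^*_z=A(z)^{-1}b(z)$; $\mathcal Y_z=\{y\in\mathbb R^n:\|A(z)y-b(z)\|_2\le\tau_{\mathcal R}\}$; $C_{\mathcal R}(z)=\|A(z)^{-1}\|_2$; for $y\in\mathcal Y_z$ the exact adjoint $\psi^*_{z,y}$ is the solution of $A(z)^{\mathsf T}\psi^*_{z,y}=\nabla_yF(z,y)$; $\mathcal A_{z,y}=\{\psi\in\mathbb R^n:\|A(z)^{\mathsf T}\psi-\nabla_yF(z,y)\|_2\le\tau_\psi\}$; $M_F(z)=\sup_{y\in\mathcal Y_z}\|\nabla_yF(z,y)\|_2$; $C_{\mathcal Y_z}=\sup_{y\in\mathcal Y_z}\|y\|_2$. The (finite) suprema over the compact set are $\overline C_{\mathcal R}=\sup_{z\in\mathcal Z_c}C_{\mathcal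 R}(z)$, $\overline C_{\mathcal Y}=\sup_{z\in\mathcal Z_c}C_{\mathcal Y_z}$, $\overline M_F=\sup_{z\in\mathcal Z_c}M_F(z)$, and $$\overline D_\psi=\big(\sqrt m\,C_A\overline C_{\mathcal Y}+C_b\big)\overline C_{\mathcal R},\qquad \overline D_{\mathcal R}=L_F\overline C_{\mathcal R}+L_F\big(\sqrt m\,C_A\overline C_{\mathcal Y}+C_b\big)\overline C_{\mathcal R}^2+\sqrt m\,C_A\overline M_F\overline C_{\mathcal R}^2.$$ (These constants depend on $\tau_{\mathcal R}$ through the sets $\mathcal Y_z$.) The inexact adjoint gradient formed from $y\in\mathcal Y_z$, $\psi\in\mathcal A_{z,y}$ is $\overline\nabla\widetilde F(z)=\nabla_zF(z,y)-\left[\frac{\partial R}{\partial z}(z,y)\right]^{\mathsf T}\psi$. The exact reduced gradient (the gradient of $\widetilde F(z)=F(z,y^*_z)$) is $\nabla\widetilde F(z)=\nabla_zF(z,y^*_z)-\left[\frac{\partial R}{\partial z}(z,y^*_z)\right]^{\mathsf T}\psi^*_{z,y^*_z}$. *)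

theory Defs
  imports "HOL-Analysis.Analysis"
begin

definition C1_map :: "('a::real_normed_vector \<Rightarrow> 'b::real_normed_vector) \<Rightarrow> bool" where
  "C1_map f \<longleftrightarrow>
     (\<exists>f' :: 'a \<Rightarrow> 'a \<Rightarrow>\<^sub>L 'b.
        (\<forall>x. (f has_derivative blinfun_apply (f' x)) (at x)) \<and> continuous_on UNIV f')"

(* The norm of the type real^'n^'m is the Frobenius norm, so the spectral norm is defined apart. *)
definition spectral_norm :: "real^'n^'m \<Rightarrow> real" where
  "spectral_norm M = onorm (\<lambda>x. M *v x)"

definition gradient :: "('a::real_inner \<Rightarrow> real) \<Rightarrow> 'a \<Rightarrow> 'a" where
  "gradient f x = (THE D. GDERIV f x :> D)"

definition partial_deriv :: "'m::finite \<Rightarrow> (real^'m \<Rightarrow> 'b::real_normed_vector) \<Rightarrow> real^'m \<Rightarrow> 'b" where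
  "partial_deriv k f z = vector_derivative (\<lambda>t. f (z + t *\<^sub>R axis k 1)) (at 0)"

definition grad_z :: "((real^'m) \<times> (real^'n) \<Rightarrow> real) \<Rightarrow> real^'m \<Rightarrow> real^'n \<Rightarrow> real^'m" where
  "grad_z F z y = gradient (\<lambda>z'. F (z', y)) z"

definition grad_y :: "((real^'m) \<times> (real^'n) \<Rightarrow> real) \<Rightarrow> real^'m \<Rightarrow> real^'n \<Rightarrow> real^'n" where
  "grad_y F z y = gradient (\<lambda>y'. F (z, y')) y"

definition residual ::
  "(real^'m \<Rightarrow> real^'n^'n) \<Rightarrow> (real^'m \<Rightarrow> real^'n) \<Rightarrow> real^'m \<Rightarrow> real^'n \<Rightarrow> real^'n" where
  "residual A b z y = A z *v y - b z"

definition residual_jacobian ::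
  "(real^'m \<Rightarrow> real^'n^'n) \<Rightarrow> (real^'m \<Rightarrow> real^'n) \<Rightarrow> real^'m \<Rightarrow> real^'n \<Rightarrow> real^'m^'n" where
  "residual_jacobian A b z y = jacobian (\<lambda>z'. residual A b z' y) (at z)"

definition exact_state ::
  "(real^'m \<Rightarrow> real^'n^'n) \<Rightarrow> (real^'m \<Rightarrow> real^'n) \<Rightarrow> real^'m \<Rightarrow> real^'n" where
  "exact_state A b z = matrix_inv (A z) *v b z"

definition inexact_states ::
  "(real^'m \<Rightarrow> real^'n^'n) \<Rightarrow> (real^'m \<Rightarrow> real^'n) \<Rightarrow> real \<Rightarrow> real^'m \<Rightarrow> (real^'n) set" where
  "inexact_states A b \<tau> z = {y. norm (residual A b z y) \<le> \<tau>}"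

definition exact_adjoint ::
  "(real^'m \<Rightarrow> real^'n^'n) \<Rightarrow> ((real^'m) \<times> (real^'n) \<Rightarrow> real) \<Rightarrow> real^'m \<Rightarrow> real^'n \<Rightarrow> real^'n" where
  "exact_adjoint A F z y = (THE \<psi>. transpose (A z) *v \<psi> = grad_y F z y)"

definition inexact_adjoints ::
  "(real^'m \<Rightarrow> real^'n^'n) \<Rightarrow> ((real^'m) \<times> (real^'n) \<Rightarrow> real) \<Rightarrow> real \<Rightarrow> real^'m \<Rightarrow> real^'n
     \<Rightarrow> (real^'n) set" where
  "inexact_adjoints A F \<tau> z y = {\<psi>. norm (transpose (A z) *v \<psi> - grad_y F z y) \<le> \<tau>}"

definition C_R :: "(real^'m \<Rightarrow> real^'n^'n) \<Rightarrow> real^'m \<Rightarrow> real" where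
  "C_R A z = spectral_norm (matrix_inv (A z))"

definition C_Y ::
  "(real^'m \<Rightarrow> real^'n^'n) \<Rightarrow> (real^'m \<Rightarrow> real^'n) \<Rightarrow> real \<Rightarrow> real^'m \<Rightarrow> real" where
  "C_Y A b \<tau> z = (SUP y \<in> inexact_states A b \<tau> z. norm y)"

definition M_F ::
  "(real^'m \<Rightarrow> real^'n^'n) \<Rightarrow> (real^'m \<Rightarrow> real^'n) \<Rightarrow> ((real^'m) \<times> (real^'n) \<Rightarrow> real)
     \<Rightarrow> real \<Rightarrow> real^'m \<Rightarrow> real" where
  "M_F A b F \<tau> z = (SUP y \<in> inexact_states A b \<tau> z. norm (grad_y F z y))"

definition C_R_bar :: "(real^'m \<Rightarrow> real^'n^'n) \<Rightarrow> (real^'m) set \<Rightarrow> real" where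
  "C_R_bar A Zc = (SUP z \<in> Zc. C_R A z)"

definition C_Y_bar ::
  "(real^'m \<Rightarrow> real^'n^'n) \<Rightarrow> (real^'m \<Rightarrow> real^'n) \<Rightarrow> real \<Rightarrow> (real^'m) set \<Rightarrow> real" where
  "C_Y_bar A b \<tau> Zc = (SUP z \<in> Zc. C_Y A b \<tau> z)"

definition M_F_bar ::
  "(real^'m \<Rightarrow> real^'n^'n) \<Rightarrow> (real^'m \<Rightarrow> real^'n) \<Rightarrow> ((real^'m) \<times> (real^'n) \<Rightarrow> real)
     \<Rightarrow> real \<Rightarrow> (real^'m) set \<Rightarrow> real" where
  "M_F_bar A b F \<tau> Zc = (SUP z \<in> Zc. M_F A b F \<tau> z)"

definition D_psi_bar ::
  "(real^'m \<Rightarrow> real^'n^'n) \<Rightarrow> (real^'m \<Rightarrow> real^'n) \<Rightarrow> real \<Rightarrow> (real^'m) set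
     \<Rightarrow> real \<Rightarrow> real \<Rightarrow> real" where
  "D_psi_bar A b \<tau> Zc C\<^sub>A C\<^sub>b =
     (sqrt (real CARD('m)) * C\<^sub>A * C_Y_bar A b \<tau> Zc + C\<^sub>b) * C_R_bar A Zc"

definition D_R_bar ::
  "(real^'m \<Rightarrow> real^'n^'n) \<Rightarrow> (real^'m \<Rightarrow> real^'n) \<Rightarrow> ((real^'m) \<times> (real^'n) \<Rightarrow> real)
     \<Rightarrow> real \<Rightarrow> (real^'m) set \<Rightarrow> real \<Rightarrow> real \<Rightarrow> real \<Rightarrow> real" where
  "D_R_bar A b F \<tau> Zc C\<^sub>A C\<^sub>b L\<^sub>F =
     L\<^sub>F * C_R_bar A Zc
     + L\<^sub>F * (sqrt (real CARD('m)) * C\<^sub>A * C_Y_bar A b \<tau> Zc + C\<^sub>b) * (C_R_bar A Zc)\<^sup>2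
     + sqrt (real CARD('m)) * C\<^sub>A * M_F_bar A b F \<tau> Zc * (C_R_bar A Zc)\<^sup>2"

definition adjoint_gradient ::
  "(real^'m \<Rightarrow> real^'n^'n) \<Rightarrow> (real^'m \<Rightarrow> real^'n) \<Rightarrow> ((real^'m) \<times> (real^'n) \<Rightarrow> real)
     \<Rightarrow> real^'m \<Rightarrow> real^'n \<Rightarrow> real^'n \<Rightarrow> real^'m" where
  "adjoint_gradient A b F z y \<psi> = grad_z F z y - transpose (residual_jacobian A b z y) *v \<psi>"

definition reduced_objective ::
  "(real^'m \<Rightarrow> real^'n^'n) \<Rightarrow> (real^'m \<Rightarrow> real^'n) \<Rightarrow> ((real^'m) \<times> (real^'n) \<Rightarrow> real)
     \<Rightarrow> real^'m \<Rightarrow> real" where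
  "reduced_objective A b F z = F (z, exact_state A b z)"

lemma gradient_eqI:
  assumes "GDERIV f x :> D"
  shows "gradient f x = D"
  unfolding gradient_def
proof (rule the_equality)
  show "GDERIV f x :> D" by (fact assms)
next
  fix D' assume "GDERIV f x :> D'"
  with assms have "(\<lambda>h. inner h D) = (\<lambda>h. inner h D')"
    unfolding gderiv_def by (rule has_derivative_unique)
  then have "inner h D = inner h D'" for h by metis
  then show "D' = D" by (metis vector_eq_ldot)
qed

lemma GDERIV_gradient:
  fixes f :: "'a::euclidean_space \<Rightarrow> real"
  assumes "f differentiable (at x)"
  shows "GDERIV f x :> gradient f x"
proof -
  obtain f' where f': "(f has_derivative f') (at x)"
    using assms by (auto simp: differentiable_def)
  then have "linear f'" by (rule has_derivative_linear)
  then have "f' = (\<lambda>h. inner h (adjoint f' 1))"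
    using adjoint_works[of f'] by (auto simp: fun_eq_iff)
  with f' have "GDERIV f x :> adjoint f' 1" unfolding gderiv_def by simp
  then show ?thesis using gradient_eqI by metis
qed

lemma C1_map_differentiable: "C1_map f \<Longrightarrow> f differentiable (at x)"
  unfolding C1_map_def differentiable_def by blast

lemma partial_deriv_eq:
  fixes f :: "real^'m \<Rightarrow> 'b::real_normed_vector"
  assumes "(f has_derivative f') (at z)"
  shows "partial_deriv k f z = f' (axis k 1)"
proof -
  have g: "((\<lambda>t. z + t *\<^sub>R axis k 1) has_derivative (\<lambda>t. t *\<^sub>R axis k 1)) (at (0::real))"
    by (auto intro!: derivative_eq_intros)
  have "((\<lambda>t. f (z + t *\<^sub>R axis k 1)) has_derivative (\<lambda>t. f' (t *\<^sub>R axis k 1))) (at (0::real))"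
    using has_derivative_compose[OF g, of f f'] assms by simp
  then have "((\<lambda>t. f (z + t *\<^sub>R axis k 1)) has_vector_derivative f' (axis k 1)) (at (0::real))"
    unfolding has_vector_derivative_def
    by (simp add: linear_cmul[OF has_derivative_linear[OF assms]])
  then show ?thesis unfolding partial_deriv_def by (rule vector_derivative_at)
qed

lemma has_derivative_matrix_vector:
  fixes A :: "'a::real_normed_vector \<Rightarrow> real^'n^'k"
  assumes "(A has_derivative A') (at z)" and "(y has_derivative y') (at z)"
  shows "((\<lambda>z. A z *v y z) has_derivative (\<lambda>h. A z *v y' h + A' h *v y z)) (at z)"
proof -
  have "bounded_bilinear (\<lambda>(M::real^'n^'k) (v::real^'n). M *v v)"
    unfolding bilinear_conv_bounded_bilinear[symmetric] bilinear_def
    by (auto intro!: linearI simp: matrix_vector_mult_add_rdistrib matrix_vector_right_distrib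
        scaleR_matrix_vector_assoc matrix_vector_mult_scaleR)
  from bounded_bilinear.FDERIV[OF this assms] show ?thesis .
qed

lemma has_derivative_residual:
  assumes "(A has_derivative A') (at z)" and "(b has_derivative b') (at z)"
  shows "((\<lambda>z'. residual A b z' y) has_derivative (\<lambda>h. A' h *v y - b' h)) (at z)"
  unfolding residual_def
  using has_derivative_diff[OF has_derivative_matrix_vector[OF assms(1) has_derivative_const] assms(2)]
  by simp

lemma jacobian_eq:
  assumes "(f has_derivative f') (at z)"
  shows "jacobian f (at z) = matrix f'"
  using frechet_derivative_at[OF assms] by (simp add: jacobian_def)

lemma residual_jacobian_eq:
  fixes A :: "real^'m \<Rightarrow> real^'n^'n" and b :: "real^'m \<Rightarrow> real^'n"
  assumes "A differentiable (at z)" and "b differentiable (at z)"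
  shows "residual_jacobian A b z y =
    (\<chi> i k. (partial_deriv k A z *v y) $ i) - jacobian b (at z)"
proof -
  obtain A' b' where *: "(A has_derivative A') (at z)" "(b has_derivative b') (at z)"
    using assms by (auto simp: differentiable_def)
  show ?thesis
    unfolding residual_jacobian_def jacobian_eq[OF has_derivative_residual[OF *]]
      jacobian_eq[OF *(2)] partial_deriv_eq[OF *(1)]
    by (simp add: vec_eq_iff matrix_def)
qed

lemma matrix_inv_mult:
  assumes "invertible (M :: real^'n^'n)"
  shows "M ** matrix_inv M = mat 1" "matrix_inv M ** M = mat 1"
  using someI_ex[OF assms[unfolded invertible_def]] unfolding matrix_inv_def by auto

lemma inner_transpose_mult:
  fixes M :: "real^'n^'k"
  shows "inner h (transpose M *v p) = inner (M *v h) p"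
  unfolding transpose_matrix_vector inner_commute[of h] dot_lmul_matrix by (rule inner_commute)

lemma exact_state_works:
  assumes "invertible (A z)"
  shows "A z *v exact_state A b z = b z"
  by (simp add: exact_state_def matrix_vector_mul_assoc matrix_inv_mult[OF assms])

lemma exact_adjoint_works:
  assumes "invertible (A z)"
  shows "transpose (A z) *v exact_adjoint A F z y = grad_y F z y"
proof -
  have inv: "invertible (transpose (A z))"
    using assms by (simp add: invertible_det_nz)
  have "\<exists>!\<psi>. transpose (A z) *v \<psi> = grad_y F z y"
  proof (rule ex1I)
    show "transpose (A z) *v (matrix_inv (transpose (A z)) *v grad_y F z y) = grad_y F z y"
      by (simp add: matrix_vector_mul_assoc matrix_inv_mult[OF inv])
    fix \<psi> assume "transpose (A z) *v \<psi> = grad_y F z y"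
    then show "\<psi> = matrix_inv (transpose (A z)) *v grad_y F z y"
      using matrix_inv_mult(2)[OF inv] by (metis matrix_vector_mul_assoc matrix_vector_mul_lid)
  qed
  then show ?thesis unfolding exact_adjoint_def by (rule theI')
qed

lemma differentiable_det:
  fixes M :: "'a::real_normed_vector \<Rightarrow> real^'n^'n"
  assumes "\<And>i j. (\<lambda>z. M z $ i $ j) differentiable (at z)"
  shows "(\<lambda>z. det (M z)) differentiable (at z)"
proof -
  have "(\<lambda>z. \<Prod>i\<in>UNIV. M z $ i $ p i) differentiable (at z)" for p
  proof -
    have D: "((\<lambda>z. M z $ i $ p i) has_derivative frechet_derivative (\<lambda>z. M z $ i $ p i) (at z)) (at z)" for i
      using assms by (simp add: frechet_derivative_works[symmetric])
    show ?thesis unfolding differentiable_def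
      by (rule exI, rule has_derivative_prod, rule D)
  qed
  then show ?thesis unfolding det_def
    by (intro differentiable_sum differentiable_mult differentiable_const ballI) simp_all
qed

lemma exact_state_differentiable:
  fixes A :: "real^'m \<Rightarrow> real^'n^'n" and b :: "real^'m \<Rightarrow> real^'n"
  assumes A: "A differentiable (at z)" and b: "b differentiable (at z)"
    and inv: "\<And>z. invertible (A z)"
  shows "exact_state A b differentiable (at z)"
proof -
  have nz: "det (A z) \<noteq> 0" for z using inv invertible_det_nz by blast
  have eq: "exact_state A b = (\<lambda>z. \<chi> k. det (\<chi> i j. if j = k then b z $ i else A z $ i $ j) / det (A z))"
    by (rule ext, rule cramer[OF nz, THEN iffD1], rule exact_state_works[of A, OF inv])
  have comp: "(\<lambda>z. f z $ i) differentiable (at z)" if "f differentiable (at z)"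
    for f :: "real^'m \<Rightarrow> 'c::real_normed_vector^'d" and i
    using that bounded_linear.has_derivative[OF bounded_linear_vec_nth]
    unfolding differentiable_def by blast
  have Aij: "(\<lambda>z. A z $ i $ j) differentiable (at z)" for i j
    by (intro comp A)
  have bi: "(\<lambda>z. b z $ i) differentiable (at z)" for i
    by (intro comp b)
  have "(\<lambda>z. exact_state A b z $ k) differentiable (at z)" for k
    unfolding eq vec_lambda_beta
  proof (intro differentiable_divide differentiable_det nz Aij)
    fix i j show "(\<lambda>z. (\<chi> i j. if j = k then b z $ i else A z $ i $ j) $ i $ j) differentiable (at z)"
      using Aij bi by (cases "j = k") auto
  qed
  then show ?thesis
    using differentiable_componentwise_within[of "exact_state A b" z UNIV]
    by (auto simp: Basis_vec_def inner_axis)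
qed

lemma gradient_reduced_objective:
  fixes A :: "real^'m \<Rightarrow> real^'n^'n" and b :: "real^'m \<Rightarrow> real^'n"
  assumes A: "A differentiable (at z)" and b: "b differentiable (at z)"
    and inv: "\<And>z. invertible (A z)"
    and F: "F differentiable (at (z, exact_state A b z))"
  shows "GDERIV (reduced_objective A b F) z :>
      adjoint_gradient A b F z (exact_state A b z) (exact_adjoint A F z (exact_state A b z))"
    and "gradient (reduced_objective A b F) z =
      adjoint_gradient A b F z (exact_state A b z) (exact_adjoint A F z (exact_state A b z))"
proof -
  let ?y = "exact_state A b z" and ?J = "residual_jacobian A b z (exact_state A b z)"
  let ?p = "exact_adjoint A F z (exact_state A b z)"
  obtain A' b' y' where A': "(A has_derivative A') (at z)" and b': "(b has_derivative b') (at z)"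
    and y': "(exact_state A b has_derivative y') (at z)"
    using A b exact_state_differentiable[OF A b inv] by (auto simp: differentiable_def)
  have "((\<lambda>z. A z *v exact_state A b z) has_derivative b') (at z)"
    using b' exact_state_works[of A, OF inv] by simp
  from has_derivative_unique[OF has_derivative_matrix_vector[OF A' y'] this]
  have lin: "A z *v y' h = - (A' h *v ?y - b' h)" for h
    by (auto simp: fun_eq_iff algebra_simps)
  have J: "?J *v h = A' h *v ?y - b' h" for h
    unfolding residual_jacobian_def jacobian_eq[OF has_derivative_residual[OF A' b']]
    using has_derivative_linear[OF has_derivative_residual[OF A' b']]
    by (simp add: matrix_works)
  let ?G = "gradient F (z, ?y)"
  have FG: "(F has_derivative (\<lambda>h. inner h ?G)) (at (z, ?y))"
    using GDERIV_gradient[OF F] by (simp add: gderiv_def)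
  have "((\<lambda>z'. F (z', ?y)) has_derivative (\<lambda>h. inner (h, 0) ?G)) (at z)"
    by (rule has_derivative_compose[where f = "\<lambda>z'. (z', ?y)", OF _ FG])
      (auto intro!: derivative_eq_intros)
  then have gz: "grad_z F z ?y = fst ?G"
    unfolding grad_z_def by (intro gradient_eqI) (simp add: gderiv_def inner_prod_def)
  have "((\<lambda>y. F (z, y)) has_derivative (\<lambda>h. inner (0, h) ?G)) (at ?y)"
    by (rule has_derivative_compose[where f = "\<lambda>y. (z, y)", OF _ FG])
      (auto intro!: derivative_eq_intros)
  then have gy: "grad_y F z ?y = snd ?G"
    unfolding grad_y_def by (intro gradient_eqI) (simp add: gderiv_def inner_prod_def)
  have "(reduced_objective A b F has_derivative (\<lambda>h. inner (h, y' h) ?G)) (at z)"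
    unfolding reduced_objective_def
    by (rule has_derivative_compose[where f = "\<lambda>z. (z, exact_state A b z)", OF _ FG])
      (auto intro!: derivative_eq_intros y')
  moreover have "inner (h, y' h) ?G = inner h (adjoint_gradient A b F z ?y ?p)" for h
  proof -
    have "inner (y' h) (snd ?G) = inner (y' h) (transpose (A z) *v ?p)"
      using exact_adjoint_works[of A z F ?y, OF inv] gy by simp
    also have "\<dots> = inner (A z *v y' h) ?p"
      by (simp only: inner_transpose_mult)
    also have "\<dots> = - inner (?J *v h) ?p" by (simp only: lin J inner_minus_left)
    also have "\<dots> = - inner h (transpose ?J *v ?p)"
      by (simp only: inner_transpose_mult)
    finally show ?thesis
      by (simp add: inner_prod_def adjoint_gradient_def gz inner_diff_right)
  qed
  ultimately show *: "GDERIV (reduced_objective A b F) z :> adjoint_gradient A b F z ?y ?p"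
    by (simp add: gderiv_def)
  then show "gradient (reduced_objective A b F) z = adjoint_gradient A b F z ?y ?p"
    by (rule gradient_eqI)
qed

end

(*
  Let u and p be the exact state and adjoint at z, q the exact adjoint at (z, y), and J(y) the partial
  Jacobian of the residual in z.  The gradient error splits as
    (grad_z F(z,y) - grad_z F(z,u)) - J(y)^T (psi - q) - J(y)^T (q - p) - (J(y) - J(u))^T p.
  The residual tolerance controls y - u and hence all terms but the second, in which the adjoint
  tolerance controls psi - q; the constants add up to D_R tau_R + D_psi tau_psi.  The suprema in these
  constants are finite because A(z) is uniformly bounded below on unit vectors for z in Zc.
*)
theory Submission
  imports Defs
begin

section \<open>Spectral norms, transposes and inverses\<close>

lemma bounded_linear_matrix_vector_mul: "bounded_linear (\<lambda>x. (M::real^'n^'k) *v x)"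
  by (simp add: linear_linear)

lemma norm_mult_le_spectral_norm:
  fixes M :: "real^'n^'k"
  shows "norm (M *v x) \<le> spectral_norm M * norm x"
  unfolding spectral_norm_def by (rule onorm[OF bounded_linear_matrix_vector_mul])

lemma spectral_norm_nonneg: "0 \<le> spectral_norm (M :: real^'n^'k)"
  unfolding spectral_norm_def by (rule onorm_pos_le[OF bounded_linear_matrix_vector_mul])

text \<open>Testing the bound on \<open>h = transpose M *v p\<close> works because the square of the
  norm of this vector is the inner product of \<open>M *v h\<close> with \<open>p\<close>;
  Cauchy-Schwarz and one cancelled factor finish. Estimates for the Jacobian can thus be proved on
  directions in z and then used on its transpose.\<close>

lemma norm_transpose_mult_le:
  fixes M :: "real^'n^'k"
  assumes "\<And>h. norm (M *v h) \<le> K * norm h"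
  shows "norm (transpose M *v p) \<le> K * norm p"
proof (cases "transpose M *v p = 0")
  case True
  \<comment> \<open>The sign of \<open>K\<close> is not among the hypotheses; evaluating the bound
    at a unit vector supplies it.\<close>
  have "0 \<le> norm (M *v axis undefined 1)" by simp
  also have "\<dots> \<le> K" using assms[of "axis undefined 1"] by simp
  finally have "0 \<le> K * norm p" by simp
  with True show ?thesis by simp
next
  case False
  let ?q = "transpose M *v p"
  have "norm ?q * norm ?q = inner (M *v ?q) p"
    by (simp only: inner_transpose_mult[symmetric] norm_eq_square power2_norm_eq_inner[symmetric] power2_eq_square)
  also have "\<dots> \<le> norm (M *v ?q) * norm p" by (rule norm_cauchy_schwarz)
  also have "\<dots> \<le> (K * norm ?q) * norm p" by (intro mult_right_mono assms norm_ge_zero)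
  finally have "norm ?q * norm ?q \<le> (K * norm p) * norm ?q" by (simp add: mult_ac)
  with False show ?thesis by simp
qed

lemma norm_le_spectral_norm_matrix_inv:
  fixes M :: "real^'n^'n"
  assumes "invertible M"
  shows "norm x \<le> spectral_norm (matrix_inv M) * norm (M *v x)"
  using norm_mult_le_spectral_norm[of "matrix_inv M" "M *v x"]
  by (simp add: matrix_vector_mul_assoc matrix_inv_mult[OF assms])

text \<open>Transposing the inverse inverts the transpose and keeps every operator bound, so the
  constant that controls the state equation controls the adjoint equation too.\<close>

lemma norm_le_spectral_norm_matrix_inv_transpose:
  fixes M :: "real^'n^'n"
  assumes "invertible M"
  shows "norm p \<le> spectral_norm (matrix_inv M) * norm (transpose M *v p)"
proof -
  have "transpose (matrix_inv M) ** transpose M = mat 1"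
    by (simp add: matrix_transpose_mul[symmetric] matrix_inv_mult[OF assms])
  then have "p = transpose (matrix_inv M) *v (transpose M *v p)"
    by (simp add: matrix_vector_mul_assoc del: transpose_matrix_vector)
  then show ?thesis
    using norm_transpose_mult_le[OF norm_mult_le_spectral_norm] by metis
qed

text \<open>Cauchy-Schwarz against the all-ones vector. The factor sqrt m in the error constants
  originates here.\<close>

lemma sum_abs_le_sqrt_card_norm:
  fixes h :: "real^'m"
  shows "(\<Sum>k\<in>UNIV. \<bar>h $ k\<bar>) \<le> sqrt (real CARD('m)) * norm h"
proof -
  have "(\<Sum>k\<in>UNIV. \<bar>h $ k\<bar>) = (\<Sum>k\<in>UNIV. \<bar>1::real\<bar> * \<bar>h $ k\<bar>)" by simp
  also have "\<dots> \<le> L2_set (\<lambda>k. 1) (UNIV::'m set) * L2_set (\<lambda>k. h $ k) UNIV"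
    by (rule L2_set_mult_ineq)
  also have "\<dots> = sqrt (real CARD('m)) * norm h" by (simp add: L2_set_def norm_vec_def)
  finally show ?thesis .
qed

section \<open>The derivative of \<open>A\<close> and the partial Jacobian of the residual\<close>

lemma linear_mult_left: "linear (\<lambda>M::real^'n^'k. M *v v)"
  by (intro linearI) (simp_all add: matrix_vector_mult_add_rdistrib scaleR_matrix_vector_assoc)

text \<open>Expanding \<open>h\<close> in the standard basis writes \<open>A' h\<close> as a
  combination of partial derivatives, each bounded by \<open>C\<close>. What remains is the sum of
  the absolute coordinates of \<open>h\<close>.\<close>

lemma norm_derivative_mult_le:
  fixes A :: "real^'m \<Rightarrow> real^'n^'k"
  assumes A': "(A has_derivative A') (at z)" and C: "\<And>k. spectral_norm (partial_deriv k A z) \<le> C"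
  shows "norm (A' h *v v) \<le> sqrt (real CARD('m)) * C * norm v * norm h"
proof -
  have lin: "linear A'" using A' by (rule has_derivative_linear)
  have C0: "0 \<le> C" by (rule order_trans[OF spectral_norm_nonneg C])
  have "A' h = A' (\<Sum>k\<in>UNIV. h $ k *\<^sub>R axis k 1)"
    by (simp add: basis_expansion scalar_mult_eq_scaleR[symmetric])
  also have "\<dots> = (\<Sum>k\<in>UNIV. h $ k *\<^sub>R partial_deriv k A z)"
    by (simp add: partial_deriv_eq[OF A'] linear_sum[OF lin] linear_cmul[OF lin])
  finally have "A' h *v v = (\<Sum>k\<in>UNIV. h $ k *\<^sub>R (partial_deriv k A z *v v))"
    by (simp add: linear_sum[OF linear_mult_left] scaleR_matrix_vector_assoc)
  also have "norm \<dots> \<le> (\<Sum>k\<in>UNIV. \<bar>h $ k\<bar> * (C * norm v))"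
  proof (rule sum_norm_le)
    fix k
    have "norm (partial_deriv k A z *v v) \<le> C * norm v"
      by (rule order_trans[OF norm_mult_le_spectral_norm mult_right_mono[OF C norm_ge_zero]])
    then show "norm (h $ k *\<^sub>R (partial_deriv k A z *v v)) \<le> \<bar>h $ k\<bar> * (C * norm v)"
      by (simp add: mult_left_mono)
  qed
  also have "\<dots> = (\<Sum>k\<in>UNIV. \<bar>h $ k\<bar>) * (C * norm v)" by (simp add: sum_distrib_right)
  also have "\<dots> \<le> sqrt (real CARD('m)) * norm h * (C * norm v)"
    by (intro mult_right_mono sum_abs_le_sqrt_card_norm mult_nonneg_nonneg C0 norm_ge_zero)
  finally show ?thesis by (simp add: mult_ac)
qed

lemma residual_jacobian_mult:
  assumes "(A has_derivative A') (at z)" and "(b has_derivative b') (at z)"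
  shows "residual_jacobian A b z y *v h = A' h *v y - b' h"
  unfolding residual_jacobian_def jacobian_eq[OF has_derivative_residual[OF assms]]
  using has_derivative_linear[OF has_derivative_residual[OF assms]]
  by (simp add: matrix_works)

text \<open>The Jacobian is affine in the state. In a difference at equal z the contribution of
  \<open>b\<close> cancels, which is why only the first bound contains
  \<open>C\<^sub>b\<close>.\<close>

lemma norm_residual_jacobian_le:
  fixes A :: "real^'m \<Rightarrow> real^'n^'n" and b :: "real^'m \<Rightarrow> real^'n"
  assumes A: "A differentiable (at z)" and b: "b differentiable (at z)"
    and CA: "\<And>k. spectral_norm (partial_deriv k A z) \<le> C\<^sub>A"
    and Cb: "spectral_norm (jacobian b (at z)) \<le> C\<^sub>b"
  shows "norm (transpose (residual_jacobian A b z y) *v p)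
      \<le> (sqrt (real CARD('m)) * C\<^sub>A * norm y + C\<^sub>b) * norm p"
    and "norm (transpose (residual_jacobian A b z y - residual_jacobian A b z y') *v p)
      \<le> sqrt (real CARD('m)) * C\<^sub>A * norm (y - y') * norm p"
proof -
  obtain A' b' where A': "(A has_derivative A') (at z)" and b': "(b has_derivative b') (at z)"
    using A b by (auto simp: differentiable_def)
  note J = residual_jacobian_mult[OF A' b']
  show "norm (transpose (residual_jacobian A b z y) *v p)
      \<le> (sqrt (real CARD('m)) * C\<^sub>A * norm y + C\<^sub>b) * norm p"
  proof (rule norm_transpose_mult_le)
    fix h
    have "b' h = jacobian b (at z) *v h"
      using has_derivative_linear[OF b'] by (simp add: jacobian_eq[OF b'] matrix_works)
    then have "norm (b' h) \<le> C\<^sub>b * norm h"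
      using order_trans[OF norm_mult_le_spectral_norm mult_right_mono[OF Cb norm_ge_zero]] by simp
    then show "norm (residual_jacobian A b z y *v h)
        \<le> (sqrt (real CARD('m)) * C\<^sub>A * norm y + C\<^sub>b) * norm h"
      unfolding J
      using norm_triangle_ineq4[of "A' h *v y" "b' h"] norm_derivative_mult_le[OF A' CA, of h y]
      by (simp add: algebra_simps)
  qed
  show "norm (transpose (residual_jacobian A b z y - residual_jacobian A b z y') *v p)
      \<le> sqrt (real CARD('m)) * C\<^sub>A * norm (y - y') * norm p"
  proof (rule norm_transpose_mult_le)
    fix h
    have "(residual_jacobian A b z y - residual_jacobian A b z y') *v h = A' h *v (y - y')"
      by (simp add: matrix_vector_mult_diff_rdistrib matrix_vector_mult_diff_distrib J)
    then show "norm ((residual_jacobian A b z y - residual_jacobian A b z y') *v h)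
        \<le> sqrt (real CARD('m)) * C\<^sub>A * norm (y - y') * norm h"
      using norm_derivative_mult_le[OF A' CA] by simp
  qed
qed

section \<open>Partial gradients of \<open>F\<close>, and invertibility over a compact set\<close>

lemma norm_fst_le_norm: "norm (fst w) \<le> norm w"
  using norm_fst_le[of "fst w" "snd w"] by simp

lemma norm_snd_le_norm: "norm (snd w) \<le> norm w"
  using norm_snd_le[of "snd w" "fst w"] by simp

text \<open>Freezing one argument composes \<open>F\<close> with an affine embedding, so the chain
  rule picks out a component of the full gradient. This lets smoothness of \<open>F\<close> in the
  pair be used for each partial gradient.\<close>

lemma partial_gradients_eq:
  fixes F :: "(real^'m) \<times> (real^'n) \<Rightarrow> real"
  assumes F: "F differentiable (at (z, y))"
  shows "grad_z F z y = fst (gradient F (z, y))" and "grad_y F z y = snd (gradient F (z, y))"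
proof -
  let ?G = "gradient F (z, y)"
  have FG: "(F has_derivative (\<lambda>h. inner h ?G)) (at (z, y))"
    using GDERIV_gradient[OF F] by (simp add: gderiv_def)
  have "((\<lambda>z'. F (z', y)) has_derivative (\<lambda>h. inner (h, 0) ?G)) (at z)"
    by (rule has_derivative_compose[where f = "\<lambda>z'. (z', y)", OF _ FG])
      (auto intro!: derivative_eq_intros)
  then show "grad_z F z y = fst ?G"
    unfolding grad_z_def by (intro gradient_eqI) (simp add: gderiv_def inner_prod_def)
  have "((\<lambda>y. F (z, y)) has_derivative (\<lambda>h. inner (0, h) ?G)) (at y)"
    by (rule has_derivative_compose[where f = "\<lambda>y. (z, y)", OF _ FG])
      (auto intro!: derivative_eq_intros)
  then show "grad_y F z y = snd ?G"
    unfolding grad_y_def by (intro gradient_eqI) (simp add: gderiv_def inner_prod_def)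
qed

text \<open>On the compact product of \<open>S\<close> with the unit sphere the norm of
  \<open>A z *v v\<close> attains its minimum, which invertibility makes positive. Its reciprocal
  serves as \<open>B\<close>, so continuity of matrix inversion does not enter.\<close>

lemma invertible_on_compact_bounded_below:
  fixes A :: "'a::t2_space \<Rightarrow> real^'n^'n"
  assumes A: "continuous_on S A" and S: "compact S" and inv: "\<And>z. z \<in> S \<Longrightarrow> invertible (A z)"
  obtains B where "0 \<le> B" and "\<And>z v. z \<in> S \<Longrightarrow> norm v \<le> B * norm (A z *v v)"
proof (cases "S = {}")
  case True
  then show ?thesis by (intro that[of 0]) auto
next
  case False
  let ?K = "S \<times> sphere (0::real^'n) 1"
  have comp: "compact ?K" using S by (intro compact_Times compact_sphere)
  have ne: "?K \<noteq> {}" using False by auto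
  have cont: "continuous_on ?K (\<lambda>p. norm (A (fst p) *v snd p))"
    unfolding matrix_vector_mult_def
    by (intro continuous_intros continuous_on_compose2[OF A]) auto
  obtain p where p: "p \<in> ?K" and min: "\<And>q. q \<in> ?K \<Longrightarrow> norm (A (fst p) *v snd p) \<le> norm (A (fst q) *v snd q)"
    using continuous_attains_inf[OF comp ne cont] by blast
  define c where "c = norm (A (fst p) *v snd p)"
  have c0: "c > 0"
  proof -
    have "invertible (A (fst p))" and "norm (snd p) = 1" using p inv by auto
    with norm_le_spectral_norm_matrix_inv[of "A (fst p)" "snd p"] have "A (fst p) *v snd p \<noteq> 0"
      by auto
    then show ?thesis by (simp add: c_def)
  qed
  show ?thesis
  proof (rule that[of "1 / c"])
    show "0 \<le> 1 / c" using c0 by simp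
    fix z v assume z: "z \<in> S"
    show "norm v \<le> 1 / c * norm (A z *v v)"
    proof (cases "v = 0")
      case False
      \<comment> \<open>Homogeneity reduces a general nonzero \<open>v\<close> to the
        sphere.\<close>
      have "c \<le> norm (A z *v ((1 / norm v) *\<^sub>R v))"
        using min[of "(z, (1 / norm v) *\<^sub>R v)"] z False by (simp add: c_def)
      also have "\<dots> = norm (A z *v v) / norm v" by (simp add: matrix_vector_mult_scaleR)
      finally show ?thesis using c0 False by (simp add: field_simps)
    qed simp
  qed
qed

section \<open>The standing assumptions and the suprema over \<open>Zc\<close>\<close>

locale adjoint_problem =
  fixes A :: "real^'m \<Rightarrow> real^'n^'n" and b :: "real^'m \<Rightarrow> real^'n"
    and F :: "(real^'m) \<times> (real^'n) \<Rightarrow> real"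
    and Zc :: "(real^'m) set" and \<tau> C\<^sub>A C\<^sub>b L\<^sub>F :: real
  assumes A: "C1_map A" and inv: "invertible (A z)" and b: "C1_map b"
    and \<tau>: "\<tau> > 0" and Zc: "compact Zc"
    and CA: "spectral_norm (partial_deriv k A z) \<le> C\<^sub>A"
    and Cb: "spectral_norm (jacobian b (at z)) \<le> C\<^sub>b"
    and F: "C1_map F"
    and LF: "norm (gradient F w\<^sub>1 - gradient F w\<^sub>2) \<le> L\<^sub>F * norm (w\<^sub>1 - w\<^sub>2)"
begin

lemma CA_nonneg: "0 \<le> C\<^sub>A"
  by (rule order_trans[OF spectral_norm_nonneg CA])

lemma LF_nonneg: "0 \<le> L\<^sub>F"
proof -
  \<comment> \<open>Any nonzero displacement would do: the Lipschitz bound forces its product with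
    \<open>L\<^sub>F\<close> to be nonnegative.\<close>
  let ?w = "(axis undefined 1, 0) :: (real^'m) \<times> (real^'n)"
  have "0 \<le> L\<^sub>F * norm ?w" using order_trans[OF norm_ge_zero LF[of ?w 0]] by simp
  then show ?thesis by (simp add: norm_Pair)
qed

lemmas partial_gradients = partial_gradients_eq[OF C1_map_differentiable[OF F]]

text \<open>The two points share their z component, so their distance is that of the states
  alone.\<close>

lemma grad_z_lipschitz: "norm (grad_z F z y\<^sub>1 - grad_z F z y\<^sub>2) \<le> L\<^sub>F * norm (y\<^sub>1 - y\<^sub>2)"
  using order_trans[OF norm_fst_le_norm LF[of "(z, y\<^sub>1)" "(z, y\<^sub>2)"]]
  by (simp add: partial_gradients norm_Pair)

lemma grad_y_lipschitz: "norm (grad_y F z y\<^sub>1 - grad_y F z y\<^sub>2) \<le> L\<^sub>F * norm (y\<^sub>1 - y\<^sub>2)"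
  using order_trans[OF norm_snd_le_norm LF[of "(z, y\<^sub>1)" "(z, y\<^sub>2)"]]
  by (simp add: partial_gradients norm_Pair)

text \<open>This makes the sets of inexact states nonempty, as the least-upper-bound arguments
  require, and brings the exact state within reach of \<open>M_F_bar\<close>.\<close>

lemma exact_state_in_inexact_states: "exact_state A b z \<in> inexact_states A b \<tau> z"
  using \<tau> by (simp add: inexact_states_def residual_def exact_state_works[of A, OF inv])

text \<open>A real \<open>SUP\<close> dominates its family only if the family is bounded. All three
  bounds come from one lower bound for \<open>A\<close> on \<open>Zc\<close>, combined with bounds
  for \<open>b\<close> and z on that compact set.\<close>

lemma exists_uniform_bounds:
  obtains B\<^sub>R B\<^sub>Y B\<^sub>F where "\<And>z. z \<in> Zc \<Longrightarrow> C_R A z \<le> B\<^sub>R"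
    and "\<And>z y. z \<in> Zc \<Longrightarrow> y \<in> inexact_states A b \<tau> z \<Longrightarrow> norm y \<le> B\<^sub>Y"
    and "\<And>z y. z \<in> Zc \<Longrightarrow> y \<in> inexact_states A b \<tau> z \<Longrightarrow> norm (grad_y F z y) \<le> B\<^sub>F"
proof -
  have cont: "continuous_on S f" if "C1_map f" for S and f :: "real^'m \<Rightarrow> 'c::real_normed_vector"
    using that C1_map_differentiable by (intro continuous_at_imp_continuous_on) (blast intro: differentiable_imp_continuous_within)
  obtain B where B0: "0 \<le> B" and B: "\<And>z v. z \<in> Zc \<Longrightarrow> norm v \<le> B * norm (A z *v v)"
    using invertible_on_compact_bounded_below[OF cont[OF A] Zc inv] by metis
  obtain \<beta> where \<beta>: "\<And>z. z \<in> Zc \<Longrightarrow> norm (b z) \<le> \<beta>"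
    using compact_imp_bounded[OF compact_continuous_image[OF cont[OF b] Zc]]
    by (auto simp: bounded_iff)
  obtain \<rho> where \<rho>: "\<And>z. z \<in> Zc \<Longrightarrow> norm z \<le> \<rho>"
    using compact_imp_bounded[OF Zc] by (auto simp: bounded_iff)
  \<comment> \<open>The lower bound for \<open>A z\<close>, read at a vector
    \<open>matrix_inv (A z) *v x\<close>, bounds the inverse.\<close>
  have R: "C_R A z \<le> B" if "z \<in> Zc" for z
    unfolding C_R_def spectral_norm_def
  proof (rule onorm_le)
    fix x show "norm (matrix_inv (A z) *v x) \<le> B * norm x"
      using B[OF that, of "matrix_inv (A z) *v x"]
      by (simp add: matrix_vector_mul_assoc matrix_inv_mult[OF inv])
  qed
  have Y: "norm y \<le> B * (\<tau> + \<beta>)" if z: "z \<in> Zc" and y: "y \<in> inexact_states A b \<tau> z" for z y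
  proof -
    have "norm (A z *v y) \<le> norm (residual A b z y) + norm (b z)"
      using norm_triangle_ineq[of "residual A b z y" "b z"] by (simp add: residual_def)
    also have "\<dots> \<le> \<tau> + \<beta>" using y \<beta>[OF z] by (simp add: inexact_states_def)
    finally show ?thesis by (rule order_trans[OF B[OF z] mult_left_mono[OF _ B0]])
  qed
  \<comment> \<open>Smoothness makes the gradient grow at most linearly away from the origin, and
    both z and y are bounded by now.\<close>
  have G: "norm (grad_y F z y) \<le> norm (gradient F 0) + L\<^sub>F * (\<rho> + B * (\<tau> + \<beta>))"
    if z: "z \<in> Zc" and y: "y \<in> inexact_states A b \<tau> z" for z y
  proof -
    have "norm (grad_y F z y) \<le> norm (gradient F (z, y))"
      unfolding partial_gradients by (rule norm_snd_le_norm)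
    also have "\<dots> \<le> norm (gradient F 0) + L\<^sub>F * norm (z, y)"
      using norm_triangle_sub[of "gradient F (z, y)" "gradient F 0"] LF[of "(z, y)" 0] by simp
    also have "\<dots> \<le> norm (gradient F 0) + L\<^sub>F * (\<rho> + B * (\<tau> + \<beta>))"
      using norm_Pair_le[of z y] \<rho>[OF z] Y[OF z y] LF_nonneg
      by (intro add_left_mono mult_left_mono) auto
    finally show ?thesis .
  qed
  from R Y G show ?thesis by (rule that)
qed

lemma C_R_le_bar:
  assumes "z \<in> Zc"
  shows "C_R A z \<le> C_R_bar A Zc"
proof -
  obtain B where B: "\<And>z. z \<in> Zc \<Longrightarrow> C_R A z \<le> B"
    by (rule exists_uniform_bounds) blast
  show ?thesis
    unfolding C_R_bar_def by (rule cSUP_upper[OF assms bdd_aboveI2]) (rule B)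
qed

text \<open>The supremum is nested, so the uniform bound serves twice: over the states at one z, and
  then for \<open>C_Y\<close> over \<open>Zc\<close>. The second use relies on each set of states
  being nonempty.\<close>

lemma norm_le_C_Y_bar:
  assumes "z \<in> Zc" and "y \<in> inexact_states A b \<tau> z"
  shows "norm y \<le> C_Y_bar A b \<tau> Zc"
proof -
  obtain B where B: "\<And>z y. z \<in> Zc \<Longrightarrow> y \<in> inexact_states A b \<tau> z \<Longrightarrow> norm y \<le> B"
    by (rule exists_uniform_bounds) blast
  have "norm y \<le> C_Y A b \<tau> z"
    unfolding C_Y_def by (rule cSUP_upper[OF assms(2) bdd_aboveI2]) (rule B[OF assms(1)])
  also have "\<dots> \<le> C_Y_bar A b \<tau> Zc"
    unfolding C_Y_bar_def
  proof (rule cSUP_upper[OF assms(1) bdd_aboveI2])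
    fix z assume "z \<in> Zc"
    then show "C_Y A b \<tau> z \<le> B"
      unfolding C_Y_def using exact_state_in_inexact_states by (intro cSUP_least B) auto
  qed
  finally show ?thesis .
qed

lemma norm_grad_y_le_M_F_bar:
  assumes "z \<in> Zc" and "y \<in> inexact_states A b \<tau> z"
  shows "norm (grad_y F z y) \<le> M_F_bar A b F \<tau> Zc"
proof -
  obtain B where B: "\<And>z y. z \<in> Zc \<Longrightarrow> y \<in> inexact_states A b \<tau> z \<Longrightarrow> norm (grad_y F z y) \<le> B"
    by (rule exists_uniform_bounds) blast
  have "norm (grad_y F z y) \<le> M_F A b F \<tau> z"
    unfolding M_F_def by (rule cSUP_upper[OF assms(2) bdd_aboveI2]) (rule B[OF assms(1)])
  also have "\<dots> \<le> M_F_bar A b F \<tau> Zc"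
    unfolding M_F_bar_def
  proof (rule cSUP_upper[OF assms(1) bdd_aboveI2])
    fix z assume "z \<in> Zc"
    then show "M_F A b F \<tau> z \<le> B"
      unfolding M_F_def using exact_state_in_inexact_states by (intro cSUP_least B) auto
  qed
  finally show ?thesis .
qed

section \<open>The absolute error of the inexact adjoint gradient\<close>

lemma adjoint_gradient_error:
  assumes z: "z \<in> Zc" and y: "y \<in> inexact_states A b \<tau> z"
    and \<psi>: "\<psi> \<in> inexact_adjoints A F \<tau>\<^sub>\<psi> z y"
  shows "norm (adjoint_gradient A b F z y \<psi> - gradient (reduced_objective A b F) z)
    \<le> D_R_bar A b F \<tau> Zc C\<^sub>A C\<^sub>b L\<^sub>F * \<tau> + D_psi_bar A b \<tau> Zc C\<^sub>A C\<^sub>b * \<tau>\<^sub>\<psi>"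
proof -
  define ys where "ys = exact_state A b z"
  define \<psi>s where "\<psi>s = exact_adjoint A F z ys"
  define \<psi>y where "\<psi>y = exact_adjoint A F z y"
  define CR where "CR = C_R_bar A Zc"
  define s where "s = sqrt (real CARD('m)) * C\<^sub>A"
  define K where "K = s * C_Y_bar A b \<tau> Zc + C\<^sub>b"
  define M where "M = M_F_bar A b F \<tau> Zc"
  let ?J = "residual_jacobian A b z"
  have s0: "0 \<le> s" using CA_nonneg by (simp add: s_def)
  have CR0: "0 \<le> CR"
    using spectral_norm_nonneg[of "matrix_inv (A z)"] C_R_le_bar[OF z] by (simp add: CR_def C_R_def)
  have CRz: "spectral_norm (matrix_inv (A z)) \<le> CR"
    using C_R_le_bar[OF z] by (simp add: CR_def C_R_def)
  have state: "norm v \<le> CR * norm (A z *v v)" for v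
    by (rule order_trans[OF norm_le_spectral_norm_matrix_inv[OF inv] mult_right_mono[OF CRz norm_ge_zero]])
  have adj: "norm p \<le> CR * norm (transpose (A z) *v p)" for p
    by (rule order_trans[OF norm_le_spectral_norm_matrix_inv_transpose[OF inv] mult_right_mono[OF CRz norm_ge_zero]])
  have works: "A z *v ys = b z" "transpose (A z) *v \<psi>s = grad_y F z ys" "transpose (A z) *v \<psi>y = grad_y F z y"
    unfolding ys_def \<psi>s_def \<psi>y_def
    by (rule exact_state_works[of A, OF inv] exact_adjoint_works[of A, OF inv])+
  have J: "norm (transpose (?J y) *v p) \<le> K * norm p" for p
  proof -
    have "norm (transpose (?J y) *v p) \<le> (s * norm y + C\<^sub>b) * norm p"
      unfolding s_def by (rule norm_residual_jacobian_le(1)[OF C1_map_differentiable[OF A] C1_map_differentiable[OF b] CA Cb])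
    also have "\<dots> \<le> K * norm p"
      unfolding K_def by (intro mult_right_mono add_right_mono mult_left_mono norm_le_C_Y_bar[OF z y] s0 norm_ge_zero)
    finally show ?thesis .
  qed
  have K0: "0 \<le> K"
    using order_trans[OF norm_ge_zero J[of "axis undefined 1"]] by simp
  have dJ: "norm (transpose (?J y - ?J ys) *v p) \<le> s * norm (y - ys) * norm p" for p
    unfolding s_def by (rule norm_residual_jacobian_le(2)[OF C1_map_differentiable[OF A] C1_map_differentiable[OF b] CA Cb])

  \<comment> \<open>Since \<open>ys\<close> solves the state equation, \<open>A z\<close> maps
    \<open>y - ys\<close> exactly to the residual at \<open>y\<close>.\<close>
  have e: "norm (y - ys) \<le> CR * \<tau>"
  proof -
    have "norm (A z *v (y - ys)) \<le> \<tau>"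
      using y by (simp add: matrix_vector_mult_diff_distrib works inexact_states_def residual_def)
    then show ?thesis by (rule order_trans[OF state mult_left_mono[OF _ CR0]])
  qed
  have Le: "L\<^sub>F * norm (y - ys) \<le> L\<^sub>F * (CR * \<tau>)" by (intro mult_left_mono e LF_nonneg)
  have T1: "norm (grad_z F z y - grad_z F z ys) \<le> L\<^sub>F * (CR * \<tau>)"
    using grad_z_lipschitz Le by (rule order_trans)
  \<comment> \<open>The transposed system maps \<open>\<psi> - \<psi>y\<close> to the adjoint
    residual; this is the only term governed by \<open>\<tau>\<^sub>\<psi>\<close>.\<close>
  have T2: "norm (transpose (?J y) *v (\<psi> - \<psi>y)) \<le> K * (CR * \<tau>\<^sub>\<psi>)"
  proof -
    have "norm (transpose (A z) *v (\<psi> - \<psi>y)) \<le> \<tau>\<^sub>\<psi>"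
      using \<psi> by (simp only: matrix_vector_mult_diff_distrib works inexact_adjoints_def mem_Collect_eq)
    then have "norm (\<psi> - \<psi>y) \<le> CR * \<tau>\<^sub>\<psi>" by (rule order_trans[OF adj mult_left_mono[OF _ CR0]])
    then show ?thesis by (rule order_trans[OF J mult_left_mono[OF _ K0]])
  qed
  \<comment> \<open>Both adjoints are exact, so their right-hand sides differ only through the
    state. Solving first for the state and then for the adjoint produces the square of
    \<open>CR\<close>.\<close>
  have T3: "norm (transpose (?J y) *v (\<psi>y - \<psi>s)) \<le> K * (CR * (L\<^sub>F * (CR * \<tau>)))"
  proof -
    have "norm (transpose (A z) *v (\<psi>y - \<psi>s)) \<le> L\<^sub>F * (CR * \<tau>)"
      unfolding matrix_vector_mult_diff_distrib works using grad_y_lipschitz Le by (rule order_trans)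
    then have "norm (\<psi>y - \<psi>s) \<le> CR * (L\<^sub>F * (CR * \<tau>))"
      by (rule order_trans[OF adj mult_left_mono[OF _ CR0]])
    then show ?thesis by (rule order_trans[OF J mult_left_mono[OF _ K0]])
  qed
  \<comment> \<open>Here one factor \<open>CR\<close> comes from the state error and the other from
    bounding \<open>\<psi>s\<close> by its right-hand side.\<close>
  have T4: "norm (transpose (?J y - ?J ys) *v \<psi>s) \<le> s * (CR * \<tau>) * (CR * M)"
  proof -
    have "norm (transpose (A z) *v \<psi>s) \<le> M"
      unfolding works M_def ys_def by (rule norm_grad_y_le_M_F_bar[OF z exact_state_in_inexact_states])
    then have "norm \<psi>s \<le> CR * M" by (rule order_trans[OF adj mult_left_mono[OF _ CR0]])
    then have "s * norm (y - ys) * norm \<psi>s \<le> s * (CR * \<tau>) * (CR * M)"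
      using e s0 CR0 \<tau> by (intro mult_mono mult_left_mono) auto
    with dJ show ?thesis by (rule order_trans)
  qed
  have "gradient (reduced_objective A b F) z = adjoint_gradient A b F z ys \<psi>s"
    unfolding ys_def \<psi>s_def
    by (rule gradient_reduced_objective(2)[OF C1_map_differentiable[OF A] C1_map_differentiable[OF b] inv
          C1_map_differentiable[OF F]])
  moreover have "transpose (?J y - ?J ys) = transpose (?J y) - transpose (?J ys)"
    by (simp add: vec_eq_iff transpose_def)
  \<comment> \<open>The adjoints \<open>\<psi>y\<close> and \<open>\<psi>s\<close> are inserted
    under the Jacobian at \<open>y\<close>; only then is the Jacobian moved to
    \<open>ys\<close>.\<close>
  ultimately have "adjoint_gradient A b F z y \<psi> - gradient (reduced_objective A b F) z =
      (grad_z F z y - grad_z F z ys) - transpose (?J y) *v (\<psi> - \<psi>y)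
      - transpose (?J y) *v (\<psi>y - \<psi>s) - transpose (?J y - ?J ys) *v \<psi>s"
    by (simp add: adjoint_gradient_def matrix_vector_mult_diff_distrib matrix_vector_mult_diff_rdistrib
        del: transpose_matrix_vector)
  also have "norm \<dots> \<le> L\<^sub>F * (CR * \<tau>) + K * (CR * \<tau>\<^sub>\<psi>) + K * (CR * (L\<^sub>F * (CR * \<tau>)))
      + s * (CR * \<tau>) * (CR * M)"
    by (intro norm_triangle_le_diff add_mono T1 T2 T3 T4)
  \<comment> \<open>The bounds \<open>T1\<close>, \<open>T3\<close> and \<open>T4\<close> give the
    three summands of \<open>D_R_bar\<close> in order, and \<open>T2\<close> gives
    \<open>D_psi_bar\<close>.\<close>
  also have "\<dots> = D_R_bar A b F \<tau> Zc C\<^sub>A C\<^sub>b L\<^sub>F * \<tau> + D_psi_bar A b \<tau> Zc C\<^sub>A C\<^sub>b * \<tau>\<^sub>\<psi>"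
    unfolding D_R_bar_def D_psi_bar_def CR_def[symmetric] s_def[symmetric] K_def[symmetric] M_def[symmetric]
    by (simp add: algebra_simps power2_eq_square)
  finally show ?thesis .
qed

end

(* Since x / D = 0 for D = 0, the first two assumptions already force D > 0. *)
lemma mult_le_of_le_divide:
  fixes \<gamma> x D :: real
  assumes "0 < \<gamma>" and "\<gamma> \<le> x / D" and "0 \<le> x"
  shows "D * \<gamma> \<le> x"
proof -
  have "0 < D"
    using assms by (smt (verit) divide_nonneg_nonpos)
  with assms show ?thesis by (simp add: field_simps)
qed

section \<open>From the tolerances to the relative error\<close>

theorem mainTheorem3:
  fixes A :: "real^'m \<Rightarrow> real^'n^'n" and b :: "real^'m \<Rightarrow> real^'n"
    and F :: "(real^'m) \<times> (real^'n) \<Rightarrow> real"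
    and Zc :: "(real^'m) set" and z :: "real^'m" and y \<psi> :: "real^'n"
    and \<tau>\<^sub>R \<tau>\<^sub>\<psi> C\<^sub>A C\<^sub>b L\<^sub>F \<zeta> \<omega> \<gamma>\<^sub>1 \<gamma>\<^sub>2 :: real
  assumes "C1_map A" and "\<And>z. invertible (A z)" and "C1_map b"
    and "\<tau>\<^sub>R > 0" and "\<tau>\<^sub>\<psi> > 0"
    and "Zc \<noteq> {}" and "compact Zc"
    and "\<And>k. \<exists>L. \<forall>z\<^sub>1 z\<^sub>2.
      spectral_norm (partial_deriv k A z\<^sub>1 - partial_deriv k A z\<^sub>2) \<le> L * norm (z\<^sub>1 - z\<^sub>2)"
    and "C\<^sub>A > 0" and "\<And>k z. spectral_norm (partial_deriv k A z) \<le> C\<^sub>A"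
    and "\<exists>L. \<forall>z\<^sub>1 z\<^sub>2.
      spectral_norm (jacobian b (at z\<^sub>1) - jacobian b (at z\<^sub>2)) \<le> L * norm (z\<^sub>1 - z\<^sub>2)"
    and "C\<^sub>b > 0" and "\<And>z. spectral_norm (jacobian b (at z)) \<le> C\<^sub>b"
    and "C1_map F" and "L\<^sub>F > 0"
    and "\<And>w\<^sub>1 w\<^sub>2. norm (gradient F w\<^sub>1 - gradient F w\<^sub>2) \<le> L\<^sub>F * norm (w\<^sub>1 - w\<^sub>2)"
    and "\<zeta> > 0" and "\<omega> \<in> {0<..<1}"
    and "\<gamma>\<^sub>1 \<in> {0<..\<omega> * \<zeta> / D_R_bar A b F \<tau>\<^sub>R Zc C\<^sub>A C\<^sub>b L\<^sub>F}"
    and "\<gamma>\<^sub>2 \<in> {0<..(1 - \<omega>) * \<zeta> / D_psi_bar A b \<tau>\<^sub>R Zc C\<^sub>A C\<^sub>b}"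
    and "z \<in> Zc" and "y \<in> inexact_states A b \<tau>\<^sub>R z" and "\<psi> \<in> inexact_adjoints A F \<tau>\<^sub>\<psi> z y"
    and "\<tau>\<^sub>R = \<gamma>\<^sub>1 * norm (adjoint_gradient A b F z y \<psi>)"
    and "\<tau>\<^sub>\<psi> = \<gamma>\<^sub>2 * norm (adjoint_gradient A b F z y \<psi>)"
  shows "norm (adjoint_gradient A b F z y \<psi> - gradient (reduced_objective A b F) z)
    \<le> \<zeta> * norm (adjoint_gradient A b F z y \<psi>)"
proof -
  interpret adjoint_problem A b F Zc \<tau>\<^sub>R C\<^sub>A C\<^sub>b L\<^sub>F
    by unfold_locales (fact assms)+
  let ?g = "norm (adjoint_gradient A b F z y \<psi>)"
  let ?D\<^sub>R = "D_R_bar A b F \<tau>\<^sub>R Zc C\<^sub>A C\<^sub>b L\<^sub>F" and ?D\<^sub>\<psi> = "D_psi_bar A b \<tau>\<^sub>R Zc C\<^sub>A C\<^sub>b"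
  \<comment> \<open>The weight \<omega> splits the relative error \<zeta> between the residual and
    the adjoint tolerance; the two shares add up again at the end.\<close>
  have \<gamma>: "?D\<^sub>R * \<gamma>\<^sub>1 \<le> \<omega> * \<zeta>" "?D\<^sub>\<psi> * \<gamma>\<^sub>2 \<le> (1 - \<omega>) * \<zeta>"
    using \<open>\<gamma>\<^sub>1 \<in> _\<close> \<open>\<gamma>\<^sub>2 \<in> _\<close> \<open>\<zeta> > 0\<close> \<open>\<omega> \<in> _\<close> by (auto intro!: mult_le_of_le_divide)
  have "norm (adjoint_gradient A b F z y \<psi> - gradient (reduced_objective A b F) z)
      \<le> ?D\<^sub>R * \<tau>\<^sub>R + ?D\<^sub>\<psi> * \<tau>\<^sub>\<psi>"
    by (rule adjoint_gradient_error) (fact assms)+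
  \<comment> \<open>The tolerance \<open>\<tau>\<^sub>R\<close> also occurs inside
    \<open>?D\<^sub>R\<close>, through the sets of inexact states. The congruence replaces only the
    outer factor and leaves the constant intact.\<close>
  also have "?D\<^sub>R * \<tau>\<^sub>R = ?D\<^sub>R * \<gamma>\<^sub>1 * ?g"
    using arg_cong[OF \<open>\<tau>\<^sub>R = _\<close>, of "\<lambda>t. ?D\<^sub>R * t"] by (simp only: mult.assoc)
  also have "?D\<^sub>\<psi> * \<tau>\<^sub>\<psi> = ?D\<^sub>\<psi> * \<gamma>\<^sub>2 * ?g"
    using arg_cong[OF \<open>\<tau>\<^sub>\<psi> = _\<close>, of "\<lambda>t. ?D\<^sub>\<psi> * t"] by (simp only: mult.assoc)
  also have "?D\<^sub>R * \<gamma>\<^sub>1 * ?g + ?D\<^sub>\<psi> * \<gamma>\<^sub>2 * ?g \<le> \<omega> * \<zeta> * ?g + (1 - \<omega>) * \<zeta> * ?g"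
    by (intro add_mono mult_right_mono \<gamma> norm_ge_zero)
  also have "\<dots> = \<zeta> * ?g" by (simp add: algebra_simps)
  finally show ?thesis .
qed

end
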